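(* Let $X$ be the set of all increasing sequences $\mathbf n=(n_k)_{k\in\mathbb N}$ of positive integers with $n_{k+1}-n_k\in\{1,2\}$ for all $k$. Then the set $$\{(\alpha,\mathbf n)\in\mathbb R\times X:\ \mathbf n\alpha\text{ is not uniformly distributed}\}$$ is residual in $\mathbb R\times X$.
   Context: $\mathbf n\alpha$ denotes the sequence $(n_k\alpha)_{k\in\mathbb N}$ taken modulo $1$; uniformly distributed means uniformly distributed with respect to Lebesgue (Haar) measure $\lambda$ on $\mathbb R/\mathbb Z$, i.e. $\frac1N\sum_{k=1}^N\delta_{n_k\alpha}\to\lambda$ weakly. $X$ carries the subspace topology inherited from the space $S_0$ of all strictly increasing sequences of positive integers, whose topology has as a base the cylinder sets $[n'_1,\ldots,n'_k]=\{\mathbf n\in S_0: n_i=n'_i \text{ for } i=1,\ldots,k\}$; $\mathbb R\times X$ carries the product topology. A set is residual if its complement is meager (of first Baire category). *)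

theory Defs
  imports "HOL-Analysis.Analysis"
begin

(* Sequences are indexed from 0 here: n 0 is the first term n_1. *)
definition incr_seqs :: "(nat \<Rightarrow> nat) set" where
  "incr_seqs = {n. strict_mono n \<and> (\<forall>k. 0 < n k)}"

definition cylinder :: "nat list \<Rightarrow> (nat \<Rightarrow> nat) set" where
  "cylinder as = {n \<in> incr_seqs. \<forall>i < length as. n i = as ! i}"

definition incr_seqs_topology :: "(nat \<Rightarrow> nat) topology" where
  "incr_seqs_topology = topology_generated_by (range cylinder)"

(* Truncated subtraction is harmless: members of incr_seqs are increasing. *)
definition seqs_gap12 :: "(nat \<Rightarrow> nat) set" where
  "seqs_gap12 = {n \<in> incr_seqs. \<forall>k. n (Suc k) - n k \<in> {1, 2}}"

(* The circle R/Z, carried by the representatives [0,1), with the quotient topology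
   along the projection frac, which is reduction modulo 1. *)
definition circle_topology :: "real topology" where
  "circle_topology = topology (\<lambda>V. V \<subseteq> {0..<1} \<and> open (frac -` V))"

(* Weak convergence on R/Z of the measures (1/N) (\<delta>_{x_1} + ... + \<delta>_{x_N}) to Haar measure,
   which on the representatives [0,1) is Lebesgue measure. *)
definition uniformly_distributed_mod1 :: "(nat \<Rightarrow> real) \<Rightarrow> bool" where
  "uniformly_distributed_mod1 x \<longleftrightarrow>
     (\<forall>f. continuous_map circle_topology euclideanreal f \<longrightarrow>
        (\<lambda>N. (\<Sum>k<N. f (frac (x k))) / real N)
          \<longlonglongrightarrow> (LINT t:{0..<1}|lborel. f t))"

definition nowhere_dense_in :: "'a topology \<Rightarrow> 'a set \<Rightarrow> bool" where
  "nowhere_dense_in T A \<longleftrightarrow> A \<subseteq> topspace T \<and> T interior_of (T closure_of A) = {}"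

definition meager_in :: "'a topology \<Rightarrow> 'a set \<Rightarrow> bool" where
  "meager_in T A \<longleftrightarrow>
     (\<exists>\<U>. countable \<U> \<and> (\<forall>U\<in>\<U>. nowhere_dense_in T U) \<and> A = \<Union>\<U>)"

definition residual_in :: "'a topology \<Rightarrow> 'a set \<Rightarrow> bool" where
  "residual_in T A \<longleftrightarrow> A \<subseteq> topspace T \<and> meager_in T (topspace T - A)"


lemma openin_circle_topology:
  "openin circle_topology V \<longleftrightarrow> V \<subseteq> {0..<1} \<and> open (frac -` V)"
proof -
  have "istopology (\<lambda>V. V \<subseteq> {0..<1} \<and> open (frac -` V :: real set))"
    unfolding istopology_def by (auto simp: vimage_Union)
  then show ?thesis by (simp add: circle_topology_def topology_inverse')
qed

lemma topspace_circle_topology: "topspace circle_topology = {0..<1}"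
proof -
  have "frac -` {0..<1} = (UNIV :: real set)"
    by (auto simp: frac_lt_1)
  then have "openin circle_topology {0..<1}"
    by (simp add: openin_circle_topology)
  then show ?thesis
    by (meson openin_circle_topology openin_subset openin_topspace subset_antisym)
qed

lemma quotient_map_frac_circle: "quotient_map euclideanreal circle_topology frac"
proof -
  have "range frac = {0..<1::real}"
  proof
    show "{0..<1::real} \<subseteq> range frac"
    proof
      fix x :: real assume "x \<in> {0..<1}"
      then have "x = frac x" by (simp add: frac_eq)
      then show "x \<in> range frac" by blast
    qed
  qed (auto simp: frac_lt_1)
  then show ?thesis
    by (auto simp: quotient_map_def topspace_circle_topology openin_circle_topology vimage_def)
qed

lemma topspace_incr_seqs_topology: "topspace incr_seqs_topology = incr_seqs"
proof -
  have "cylinder [] = incr_seqs" by (simp add: cylinder_def)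
  moreover have "cylinder as \<subseteq> incr_seqs" for as by (auto simp: cylinder_def)
  ultimately show ?thesis
    unfolding incr_seqs_topology_def topology_generated_by_topspace by blast
qed

(* The cylinders form a base, not merely a subbase. *)
lemma openin_incr_seqs_topology:
  "openin incr_seqs_topology U \<longleftrightarrow>
     U \<subseteq> incr_seqs \<and> (\<forall>n\<in>U. \<exists>as. n \<in> cylinder as \<and> cylinder as \<subseteq> U)"
proof
  assume "openin incr_seqs_topology U"
  then have gen: "generate_topology_on (range cylinder) U"
    by (simp add: incr_seqs_topology_def openin_topology_generated_by_iff)
  from gen have "\<forall>n\<in>U. \<exists>as. n \<in> cylinder as \<and> cylinder as \<subseteq> U"
  proof induction
    case (Int a b)
    show ?case
    proof
      fix n assume "n \<in> a \<inter> b"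
      then obtain as bs where as: "n \<in> cylinder as" "cylinder as \<subseteq> a"
        and bs: "n \<in> cylinder bs" "cylinder bs \<subseteq> b"
        using Int.IH by blast
      let ?cs = "map n [0..<max (length as) (length bs)]"
      have "n \<in> cylinder ?cs" "cylinder ?cs \<subseteq> cylinder as" "cylinder ?cs \<subseteq> cylinder bs"
        using as(1) bs(1) by (auto simp: cylinder_def)
      then show "\<exists>cs. n \<in> cylinder cs \<and> cylinder cs \<subseteq> a \<inter> b"
        using as bs by blast
    qed
  qed blast+
  moreover have "U \<subseteq> incr_seqs"
    using \<open>openin incr_seqs_topology U\<close> openin_subset topspace_incr_seqs_topology by blast
  ultimately show "U \<subseteq> incr_seqs \<and> (\<forall>n\<in>U. \<exists>as. n \<in> cylinder as \<and> cylinder as \<subseteq> U)" by blast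
next
  assume R: "U \<subseteq> incr_seqs \<and> (\<forall>n\<in>U. \<exists>as. n \<in> cylinder as \<and> cylinder as \<subseteq> U)"
  have "openin incr_seqs_topology (cylinder as)" for as
    by (simp add: incr_seqs_topology_def topology_generated_by_Basis)
  with R show "openin incr_seqs_topology U"
    by (subst openin_subopen) blast
qed

end

theory Submission
  imports Defs
begin

text \<open>
  Test uniform distribution against the zero-mean function \<open>cos (2 \<pi> t)\<close>. Any finite prefix of
  a sequence in \<open>X\<close> can be continued so as to omit exactly those even integers \<open>m\<close> for which
  \<open>cos (2 \<pi> m \<alpha>) < 0\<close>; since no two consecutive integers are omitted, the gaps stay in \<open>{1, 2}\<close>.
  If \<open>4 \<alpha>\<close> is not an integer, the full cosine sums are bounded, while the omitted negative
  terms amount to a positive proportion, so that the averages eventually exceed \<open>1/16\<close>.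
  Hence, for each \<open>k\<close>, the open set where some average with index \<open>N \<ge> k\<close> exceeds \<open>1/16\<close> is dense.
\<close>

section \<open>Bounded cosine sums along arithmetic progressions\<close>

text \<open>The sum is the real part of a unimodular factor times a geometric series with ratio
  \<open>cis \<theta>\<close>. The bound depends on neither the length nor the phase.\<close>

lemma abs_sum_cos_arith_le:
  assumes "cis \<theta> \<noteq> 1"
  shows "\<bar>\<Sum>j<M. cos (\<phi> + real j * \<theta>)\<bar> \<le> 2 / norm (1 - cis \<theta>)"
proof -
  have "(\<Sum>j<M. cos (\<phi> + real j * \<theta>)) = Re (cis \<phi> * (\<Sum>j<M. cis \<theta> ^ j))"
    by (simp add: Complex.DeMoivre sum_distrib_left cis_mult del: times_complex.sel)
  then have "\<bar>\<Sum>j<M. cos (\<phi> + real j * \<theta>)\<bar> \<le> norm (\<Sum>j<M. cis \<theta> ^ j)"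
    by (metis abs_Re_le_cmod mult_1 norm_cis norm_mult)
  also have "\<dots> = norm (1 - cis \<theta> ^ M) / norm (1 - cis \<theta>)"
    using assms by (simp add: sum_gp_strict norm_divide)
  also have "\<dots> \<le> 2 / norm (1 - cis \<theta>)"
    using norm_triangle_ineq4[of 1 "cis \<theta> ^ M"]
    by (intro divide_right_mono) (auto simp: norm_power)
  finally show ?thesis .
qed

section \<open>Omitting even integers with negative cosine\<close>

text \<open>The parameter \<open>x\<close> is the angle 2 pi times \<alpha>, not \<alpha>
  itself.\<close>

definition skipped :: "real \<Rightarrow> nat \<Rightarrow> bool" where
  "skipped x m \<longleftrightarrow> even m \<and> cos (real m * x) < 0"

text \<open>A skipped \<open>Suc v\<close> is even, so \<open>Suc (Suc v)\<close> is odd and never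
  skipped. The value is thus the least unskipped integer above \<open>v\<close>.\<close>

definition next_unskipped :: "real \<Rightarrow> nat \<Rightarrow> nat" where
  "next_unskipped x v = (if skipped x (Suc v) then Suc (Suc v) else Suc v)"

definition unskipped_cos :: "real \<Rightarrow> nat \<Rightarrow> real" where
  "unskipped_cos x m = (if skipped x m then 0 else cos (real m * x))"

text \<open>For even \<open>m\<close> the right side is max(c, 0) with c the cosine, and max(c, 0)
  >= (c + c^2) / 2 on [-1, 1]. Writing c^2 by the double angle leaves the constant 1/4 plus pure
  cosines, whose sums stay bounded.\<close>

lemma unskipped_cos_even_ge:
  assumes "even m"
  shows "(cos (real m * x) + (1 + cos (2 * (real m * x))) / 2) / 2 \<le> unskipped_cos x m"
proof -
  define c where "c = cos (real m * x)"
  have c: "- 1 \<le> c" "c \<le> 1" by (simp_all add: c_def)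
  have "(1 + cos (2 * (real m * x))) / 2 = c * c"
    by (simp only: cos_double_cos c_def power2_eq_square) simp
  moreover have "(c + c * c) / 2 \<le> (if c < 0 then 0 else c)"
  proof (cases "c < 0")
    case True
    then have "c * (1 + c) \<le> 0" using c by (intro mult_nonpos_nonneg) auto
    then show ?thesis using True by (simp add: algebra_simps)
  next
    case False
    then have "c * c \<le> c * 1" using c by (intro mult_left_mono) auto
    then show ?thesis using False by simp
  qed
  ultimately show ?thesis
    using assms unfolding unskipped_cos_def skipped_def c_def[symmetric] by simp
qed

text \<open>Each even term contributes 1/4 up to cosines of angles \<open>2 * x\<close> and
  \<open>4 * x\<close>, and the odd terms are cosines advancing by \<open>2 * x\<close>. One gain of
  1/4 per two integers gives the slope 1/8.\<close>

lemma sum_unskipped_cos_lower_bound: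
  assumes "cis (2 * x) \<noteq> 1" "cis (4 * x) \<noteq> 1"
  obtains C where "\<And>v. (\<Sum>m\<le>v. unskipped_cos x m) \<ge> real v / 8 - C"
proof -
  define C2 where "C2 = 2 / norm (1 - cis (2 * x))"
  define C4 where "C4 = 2 / norm (1 - cis (4 * x))"
  \<comment> \<open>The even terms cost at most C2/2 + C4/4 and the odd terms at most C2; the
    constant rounds this up.\<close>
  have pairs: "(\<Sum>m<2 * M. unskipped_cos x m) \<ge> real M / 4 - (2 * C2 + C4)" for M
  proof -
    have eq: "(\<Sum>m<2 * M. unskipped_cos x m) =
        (\<Sum>j<M. unskipped_cos x (2 * j) + unskipped_cos x (2 * j + 1))"
      by (induction M) auto
    have "unskipped_cos x (2 * j) + unskipped_cos x (2 * j + 1) \<ge>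
        1 / 4 + cos (0 + real j * (2 * x)) / 2 + cos (0 + real j * (4 * x)) / 4
          + cos (x + real j * (2 * x))" for j
    proof -
      have "unskipped_cos x (2 * j + 1) = cos (x + real j * (2 * x))"
        by (simp add: unskipped_cos_def skipped_def algebra_simps)
      moreover have "(cos (real j * (2 * x)) + (1 + cos (real j * (4 * x))) / 2) / 2
          \<le> unskipped_cos x (2 * j)"
        using unskipped_cos_even_ge[of "2 * j" x] by (simp add: algebra_simps)
      ultimately show ?thesis by (simp add: field_simps)
    qed
    then have "(\<Sum>m<2 * M. unskipped_cos x m) \<ge>
        (\<Sum>j<M. 1 / 4 + cos (0 + real j * (2 * x)) / 2 + cos (0 + real j * (4 * x)) / 4
          + cos (x + real j * (2 * x)))"
      unfolding eq by (intro sum_mono)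
    also have "(\<Sum>j<M. 1 / 4 + cos (0 + real j * (2 * x)) / 2 + cos (0 + real j * (4 * x)) / 4
          + cos (x + real j * (2 * x))) =
        real M / 4 + (\<Sum>j<M. cos (0 + real j * (2 * x))) / 2
          + (\<Sum>j<M. cos (0 + real j * (4 * x))) / 4 + (\<Sum>j<M. cos (x + real j * (2 * x)))"
      by (simp only: sum.distrib sum_divide_distrib[symmetric]) simp
    finally show ?thesis
      using abs_sum_cos_arith_le[OF assms(1), of 0 M] abs_sum_cos_arith_le[OF assms(1), of x M]
        abs_sum_cos_arith_le[OF assms(2), of 0 M]
      unfolding C2_def[symmetric] C4_def[symmetric] by linarith
  qed
  \<comment> \<open>For even \<open>v\<close> the last term is unpaired and is at least -1, which
    accounts for the extra 1.\<close>
  have "(\<Sum>m\<le>v. unskipped_cos x m) \<ge> real v / 8 - (2 * C2 + C4 + 1)" for v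
  proof (cases "even v")
    case True
    then obtain M where "v = 2 * M" by blast
    moreover have "unskipped_cos x v \<ge> - 1" by (simp add: unskipped_cos_def)
    ultimately show ?thesis
      using pairs[of M] by (simp flip: lessThan_Suc_atMost)
  next
    case False
    then obtain M where "v = 2 * M + 1" using oddE by blast
    then have v: "{..v} = {..<2 * Suc M}" "real v \<le> 2 * real (Suc M)"
      by (auto simp flip: lessThan_Suc_atMost)
    then show ?thesis
      using pairs[of "Suc M"] unfolding v(1) by linarith
  qed
  then show ?thesis by (rule that)
qed

text \<open>A jumped integer contributes 0 and the landing point is unskipped. Hence sums along the
  sequence can be traded for sums over all integers.\<close>

lemma sum_unskipped_cos_next:
  "(\<Sum>m\<le>next_unskipped x v. unskipped_cos x m) =
    (\<Sum>m\<le>v. unskipped_cos x m) + cos (real (next_unskipped x v) * x)"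
  by (auto simp: next_unskipped_def unskipped_cos_def skipped_def)

section \<open>Continuing a prefix within the sequence space\<close>

lemma strict_mono_if_gap12:
  assumes "\<And>k. n (Suc k) = n k + 1 \<or> n (Suc k) = n k + (2::nat)"
  shows "strict_mono n"
proof (rule strict_monoI_Suc)
  show "n k < n (Suc k)" for k using assms[of k] by auto
qed

text \<open>This form avoids truncated subtraction; monotonicity, and positivity beyond index 0,
  follow from the gap condition.\<close>

lemma seqs_gap12_iff:
  "n \<in> seqs_gap12 \<longleftrightarrow> 0 < n 0 \<and> (\<forall>k. n (Suc k) = n k + 1 \<or> n (Suc k) = n k + 2)"
proof
  assume n: "n \<in> seqs_gap12"
  have "n (Suc k) = n k + 1 \<or> n (Suc k) = n k + 2" for k
  proof -
    have "n (Suc k) - n k = 1 \<or> n (Suc k) - n k = 2"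
      using n by (simp add: seqs_gap12_def)
    then show ?thesis by linarith
  qed
  with n show "0 < n 0 \<and> (\<forall>k. n (Suc k) = n k + 1 \<or> n (Suc k) = n k + 2)"
    by (simp add: seqs_gap12_def incr_seqs_def)
next
  assume R: "0 < n 0 \<and> (\<forall>k. n (Suc k) = n k + 1 \<or> n (Suc k) = n k + 2)"
  then have mono: "strict_mono n" by (intro strict_mono_if_gap12) blast
  have "n 0 \<le> n k" for k
    using mono by (simp add: strict_mono_less_eq)
  with R have "0 < n k" for k by (meson order_less_le_trans)
  moreover have "n (Suc k) - n k \<in> {1, 2}" for k
    using R[THEN conjunct2, rule_format, of k] by auto
  ultimately show "n \<in> seqs_gap12"
    using mono by (simp add: seqs_gap12_def incr_seqs_def)
qed

definition continue_unskipped :: "real \<Rightarrow> nat \<Rightarrow> (nat \<Rightarrow> nat) \<Rightarrow> nat \<Rightarrow> nat" where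
  "continue_unskipped x K n i = (if i \<le> K then n i else (next_unskipped x ^^ (i - K)) (n K))"

lemma continue_unskipped_Suc:
  assumes "K \<le> i"
  shows "continue_unskipped x K n (Suc i) = next_unskipped x (continue_unskipped x K n i)"
  using assms by (auto simp: continue_unskipped_def Suc_diff_le)

lemma continue_unskipped_in_seqs_gap12:
  assumes "n \<in> seqs_gap12"
  shows "continue_unskipped x K n \<in> seqs_gap12"
proof -
  have "continue_unskipped x K n (Suc i) = continue_unskipped x K n i + 1 \<or>
      continue_unskipped x K n (Suc i) = continue_unskipped x K n i + 2" for i
  proof (cases "K \<le> i")
    case True
    then show ?thesis by (simp add: continue_unskipped_Suc next_unskipped_def)
  next
    case False
    then show ?thesis using assms by (simp add: continue_unskipped_def seqs_gap12_iff)
  qed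
  then show ?thesis
    using assms by (simp add: seqs_gap12_iff) (simp add: continue_unskipped_def)
qed

section \<open>Cosine averages along the continued sequence\<close>

definition cos_avg :: "nat \<Rightarrow> real \<Rightarrow> (nat \<Rightarrow> nat) \<Rightarrow> real" where
  "cos_avg N \<alpha> n = (\<Sum>i<N. cos (2 * pi * (real (n i) * \<alpha>))) / real N"

text \<open>From index \<open>K\<close> on, the partial sums differ from the full sums
  \<open>G\<close> only by a constant. Since \<open>p i\<close> is at least \<open>i\<close>,
  \<open>G\<close> grows with slope at least 1/8 in the index; half of that slope absorbs all
  constants.\<close>

lemma cos_avg_continue_unskipped:
  assumes n: "n \<in> seqs_gap12" and \<alpha>: "4 * \<alpha> \<notin> \<int>"
  shows "\<forall>\<^sub>F N in sequentially. 1 / 16 < cos_avg N \<alpha> (continue_unskipped (2 * pi * \<alpha>) K n)"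
proof -
  define x where "x = 2 * pi * \<alpha>"
  define p where "p = continue_unskipped x K n"
  define G where "G v = (\<Sum>m\<le>v. unskipped_cos x m)" for v
  have cis: "cis (4 * x) \<noteq> 1"
  proof
    assume "cis (4 * x) = 1"
    then have "cos (4 * x) = 1" by (simp add: complex_eq_iff)
    then obtain k :: int where "4 * x = of_int k * (2 * pi)"
      by (auto simp: cos_one_2pi_int)
    then have "4 * \<alpha> = of_int k" by (simp add: x_def)
    then show False using \<alpha> by simp
  qed
  moreover have "cis (2 * x) \<noteq> 1"
  proof
    assume "cis (2 * x) = 1"
    then have "cis (2 * x) * cis (2 * x) = 1" by simp
    then show False using cis by (simp add: cis_mult)
  qed
  ultimately obtain C where C: "\<And>v. G v \<ge> real v / 8 - C"
    unfolding G_def using sum_unskipped_cos_lower_bound by metis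
  \<comment> \<open>The arbitrary prefix may use skipped integers or miss unskipped ones;
    \<open>D\<close> records this fixed discrepancy.\<close>
  define D where "D = (\<Sum>i\<le>K. cos (real (p i) * x)) - G (p K)"
  have sum_eq: "(\<Sum>i\<le>K + j. cos (real (p i) * x)) = D + G (p (K + j))" for j
  proof (induction j)
    case (Suc j)
    have "p (K + Suc j) = next_unskipped x (p (K + j))"
      by (simp add: p_def continue_unskipped_Suc)
    then have "G (p (K + Suc j)) = G (p (K + j)) + cos (real (p (K + Suc j)) * x)"
      unfolding G_def by (simp add: sum_unskipped_cos_next)
    with Suc show ?case by simp
  qed (simp add: D_def)
  have "p \<in> seqs_gap12"
    unfolding p_def using n by (rule continue_unskipped_in_seqs_gap12)
  then have "strict_mono p" by (simp add: seqs_gap12_def incr_seqs_def)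
  then have p_ge: "real i \<le> real (p i)" for i by (simp add: strict_mono_imp_increasing)
  \<comment> \<open>The target D + (N - 1)/8 - C > N/16 amounts to N > 16 (C - D + 1/8).\<close>
  obtain N0 :: nat where N0: "real N0 > 16 * (C - D + 1)"
    using reals_Archimedean2 by blast
  have "1 / 16 < cos_avg N \<alpha> p" if N: "N \<ge> Suc K + N0" for N
  proof -
    define j where "j = N - Suc K"
    have Nj: "N = Suc (K + j)" using N by (simp add: j_def)
    have "(\<Sum>i<N. cos (real (p i) * x)) = D + G (p (K + j))"
      using sum_eq[of j] by (simp add: Nj lessThan_Suc_atMost)
    also have "\<dots> \<ge> D + real (p (K + j)) / 8 - C" using C[of "p (K + j)"] by simp
    finally have "(\<Sum>i<N. cos (real (p i) * x)) \<ge> D + real (p (K + j)) / 8 - C" .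
    moreover have "real N - 1 \<le> real (p (K + j))" using p_ge[of "K + j"] by (simp add: Nj)
    moreover have "real N \<ge> real N0" "real N > 0" using N by simp_all
    ultimately have "(\<Sum>i<N. cos (real (p i) * x)) > real N / 16"
      using N0 by argo
    then show ?thesis
      using \<open>real N > 0\<close> by (simp add: cos_avg_def x_def field_simps)
  qed
  then show ?thesis
    unfolding p_def x_def by (auto simp: eventually_sequentially)
qed

section \<open>The cosine as a test function on the circle\<close>

lemma cos_frac: "cos (2 * pi * frac t) = cos (2 * pi * t)"
proof -
  have "cos (2 * pi * t) = cos (2 * pi * frac t + 2 * pi * of_int \<lfloor>t\<rfloor>)"
    by (simp add: frac_def algebra_simps)
  then show ?thesis by (simp add: cos_add)
qed

lemma integral_cos_circle: "(LINT t:{0..<1}|lborel. cos (2 * pi * t)) = 0"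
proof -
  have "((\<lambda>t. cos (2 * pi * t)) has_integral
      sin (2 * pi * 1) / (2 * pi) - sin (2 * pi * 0) / (2 * pi)) {0..1}"
    by (rule fundamental_theorem_of_calculus)
      (auto intro!: derivative_eq_intros simp flip: has_real_derivative_iff_has_vector_derivative)
  then have "integral {0..1} (\<lambda>t. cos (2 * pi * t)) = 0"
    by (simp add: integral_unique)
  moreover have int: "set_integrable lborel {0..1} (\<lambda>t. cos (2 * pi * t))"
    by (intro borel_integrable_atLeastAtMost') (intro continuous_intros)
  ultimately have "(LINT t:{0..1}|lborel. cos (2 * pi * t)) = 0"
    by (simp add: set_borel_integral_eq_integral)
  \<comment> \<open>The two intervals differ only in the null set {1}.\<close>
  moreover have "(LINT t:{0..<1}|lborel. cos (2 * pi * t)) = (LINT t:{0..1}|lborel. cos (2 * pi * t))"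
  proof (rule set_integral_cong_set)
    show "AE t in lborel. (t \<in> {0..1}) = (t \<in> {0..<1::real})"
      using AE_lborel_singleton[of "1::real"] by eventually_elim auto
  qed (auto simp: set_borel_measurable_def)
  ultimately show ?thesis by simp
qed

lemma cos_avg_tendsto_0:
  assumes "uniformly_distributed_mod1 (\<lambda>k. real (n k) * \<alpha>)"
  shows "(\<lambda>N. cos_avg N \<alpha> n) \<longlonglongrightarrow> 0"
proof -
  have "continuous_map euclideanreal euclideanreal (\<lambda>t. cos (2 * pi * t))"
    by (auto intro!: continuous_intros)
  \<comment> \<open>Although \<open>frac\<close> jumps at integers, periodicity makes this composite
    the cosine itself, so continuity descends along the quotient map.\<close>
  then have "continuous_map euclideanreal euclideanreal ((\<lambda>t. cos (2 * pi * t)) \<circ> frac)"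
    by (simp add: o_def cos_frac)
  then have "continuous_map circle_topology euclideanreal (\<lambda>t. cos (2 * pi * t))"
    using continuous_compose_quotient_map_eq[OF quotient_map_frac_circle] by blast
  then have "(\<lambda>N. (\<Sum>k<N. cos (2 * pi * frac (real (n k) * \<alpha>))) / real N)
      \<longlonglongrightarrow> (LINT t:{0..<1}|lborel. cos (2 * pi * t))"
    using assms unfolding uniformly_distributed_mod1_def by blast
  then show ?thesis
    by (simp add: cos_frac integral_cos_circle cos_avg_def)
qed

section \<open>Baire category in the product space\<close>

abbreviation gap12_space :: "(real \<times> (nat \<Rightarrow> nat)) topology" where
  "gap12_space \<equiv> prod_topology euclideanreal (subtopology incr_seqs_topology seqs_gap12)"

lemma topspace_gap12_space: "topspace gap12_space = UNIV \<times> seqs_gap12"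
  by (auto simp: topspace_incr_seqs_topology seqs_gap12_def)

text \<open>The average depends on only the first \<open>N\<close> entries, so it is constant on a
  cylinder in the sequence variable and continuous in \<alpha>.\<close>

lemma openin_cos_avg_greater:
  "openin gap12_space {(\<alpha>, n). n \<in> seqs_gap12 \<and> c < cos_avg N \<alpha> n}"
  unfolding openin_prod_topology_alt
proof (intro allI impI)
  fix \<alpha> n assume "(\<alpha>, n) \<in> {(\<alpha>, n). n \<in> seqs_gap12 \<and> c < cos_avg N \<alpha> n}"
  then have n: "n \<in> seqs_gap12" and gt: "c < cos_avg N \<alpha> n" by auto
  have "n \<in> cylinder (map n [0..<N])"
    using n by (auto simp: cylinder_def seqs_gap12_def)
  moreover have "openin incr_seqs_topology (cylinder as)" for as
    by (simp add: incr_seqs_topology_def topology_generated_by_Basis)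
  moreover have "open {\<beta>. c < cos_avg N \<beta> n}"
    \<comment> \<open>Multiplication by the constant \<open>inverse (real N)\<close> is continuous
      even for \<open>N = 0\<close>, where division would demand a nonzero denominator.\<close>
    unfolding cos_avg_def divide_inverse
    by (intro open_Collect_less continuous_intros)
  moreover have "cos_avg N \<beta> m = cos_avg N \<beta> n" if "m \<in> cylinder (map n [0..<N])" for \<beta> m
    using that by (auto simp: cylinder_def cos_avg_def)
  then have "{\<beta>. c < cos_avg N \<beta> n} \<times> (seqs_gap12 \<inter> cylinder (map n [0..<N])) \<subseteq>
      {(\<alpha>, n). n \<in> seqs_gap12 \<and> c < cos_avg N \<alpha> n}"
    by auto
  ultimately show "\<exists>U V. openin euclideanreal U \<and>
      openin (subtopology incr_seqs_topology seqs_gap12) V \<and> \<alpha> \<in> U \<and> n \<in> V \<and>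
      U \<times> V \<subseteq> {(\<alpha>, n). n \<in> seqs_gap12 \<and> c < cos_avg N \<alpha> n}"
    using n gt
    by (intro exI[of _ "{\<beta>. c < cos_avg N \<beta> n}"]
        exI[of _ "seqs_gap12 \<inter> cylinder (map n [0..<N])"] conjI openin_subtopology_Int2)
      (simp_all only: open_openin mem_Collect_eq Int_iff simp_thms)
qed

text \<open>The set is closed, as its complement is a union of open sets. Every basic open set
  leaves it: perturb \<alpha> to an irrational and continue the fixed prefix by omitting negative
  terms.\<close>

lemma nowhere_dense_cos_avg_le:
  "nowhere_dense_in gap12_space {(\<alpha>, n). n \<in> seqs_gap12 \<and> (\<forall>N\<ge>k. cos_avg N \<alpha> n \<le> 1 / 16)}"
    (is "nowhere_dense_in _ ?A")
proof -
  have "?A = topspace gap12_space -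
      (\<Union>N\<in>{k..}. {(\<alpha>, n). n \<in> seqs_gap12 \<and> 1 / 16 < cos_avg N \<alpha> n})"
    unfolding topspace_gap12_space by (auto simp: not_less)
  then have "closedin gap12_space ?A"
    by (simp only:)
      (intro closedin_diff closedin_topspace openin_Union ballI, use openin_cos_avg_greater in blast)
  then have "gap12_space closure_of ?A = ?A" by (rule closure_of_closedin)
  moreover have "gap12_space interior_of ?A = {}"
  proof (rule ccontr)
    assume "gap12_space interior_of ?A \<noteq> {}"
    then obtain \<alpha> n W where W: "openin gap12_space W" "(\<alpha>, n) \<in> W" "W \<subseteq> ?A"
      unfolding interior_of_def by auto
    obtain U V where U: "openin euclideanreal U" "\<alpha> \<in> U"
      and V: "openin (subtopology incr_seqs_topology seqs_gap12) V" "n \<in> V"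
      and UV: "U \<times> V \<subseteq> W"
      using W(1)[unfolded openin_prod_topology_alt, rule_format, OF W(2)] by blast
    obtain T where T: "openin incr_seqs_topology T" "V = T \<inter> seqs_gap12"
      using V(1) unfolding openin_subtopology by blast
    then obtain as where as: "n \<in> cylinder as" "cylinder as \<subseteq> T"
      using V(2) unfolding openin_incr_seqs_topology by blast
    have "open U" using U(1) by (simp only: open_openin)
    then obtain \<beta> where \<beta>: "\<beta> \<in> U" "\<beta> \<notin> \<rat>"
      using open_minus_countable[OF countable_rat] U(2) by blast
    have "4 * \<beta> \<notin> \<int>"
    proof
      assume "4 * \<beta> \<in> \<int>"
      then have "4 * \<beta> / 4 \<in> \<rat>" using Ints_subset_Rats by (intro Rats_divide) auto
      then show False using \<beta> by simp
    qed
    \<comment> \<open>Keeping indices up to \<open>length as\<close> preserves one entry more than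
      the cylinder fixes, so an empty prefix still has a starting value.\<close>
    let ?p = "continue_unskipped (2 * pi * \<beta>) (length as) n"
    have n: "n \<in> seqs_gap12"
      using T V by blast
    have "\<forall>\<^sub>F N in sequentially. 1 / 16 < cos_avg N \<beta> ?p"
      using n \<open>4 * \<beta> \<notin> \<int>\<close> by (rule cos_avg_continue_unskipped)
    then have "\<forall>\<^sub>F N in sequentially. k \<le> N \<and> 1 / 16 < cos_avg N \<beta> ?p"
      using eventually_ge_at_top by (rule eventually_conj[rotated])
    then obtain N where N: "N \<ge> k" "1 / 16 < cos_avg N \<beta> ?p"
      using eventually_happens'[OF sequentially_bot] by blast
    have p: "?p \<in> seqs_gap12"
      using n by (rule continue_unskipped_in_seqs_gap12)
    then have "?p \<in> cylinder as"
      using as(1) by (auto simp: cylinder_def continue_unskipped_def seqs_gap12_def)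
    then have "(\<beta>, ?p) \<in> ?A"
      using p as(2) T(2) \<beta>(1) UV W(3) by blast
    with N show False by auto
  qed
  moreover have "?A \<subseteq> topspace gap12_space"
    unfolding topspace_gap12_space by auto
  ultimately show ?thesis by (simp add: nowhere_dense_in_def)
qed

lemma nowhere_dense_in_subset:
  assumes "nowhere_dense_in T B" "A \<subseteq> B"
  shows "nowhere_dense_in T A"
proof -
  have "T interior_of (T closure_of A) \<subseteq> T interior_of (T closure_of B)"
    using assms(2) by (intro interior_of_mono closure_of_mono)
  then show ?thesis
    using assms by (simp add: nowhere_dense_in_def) (metis subset_trans)
qed

theorem theorem2p7:
  shows "residual_in
     (prod_topology euclideanreal (subtopology incr_seqs_topology seqs_gap12))
     {(\<alpha>, n). n \<in> seqs_gap12 \<and> \<not> uniformly_distributed_mod1 (\<lambda>k. real (n k) * \<alpha>)}"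
    (is "residual_in _ ?R")
proof -
  define E where "E = topspace gap12_space - ?R"
  define B where "B k = {(\<alpha>, n). n \<in> seqs_gap12 \<and> (\<forall>N\<ge>k. cos_avg N \<alpha> n \<le> 1 / 16)}" for k
  \<comment> \<open>Uniform distribution sends the averages to 0, hence eventually below
    1/16.\<close>
  have "E \<subseteq> (\<Union>k. B k)"
  proof clarify
    fix \<alpha> n assume "(\<alpha>, n) \<in> E"
    then have n: "n \<in> seqs_gap12" "uniformly_distributed_mod1 (\<lambda>k. real (n k) * \<alpha>)"
      unfolding E_def topspace_gap12_space by auto
    have "\<forall>\<^sub>F N in sequentially. cos_avg N \<alpha> n < 1 / 16"
      using cos_avg_tendsto_0[OF n(2)] by (rule order_tendstoD) simp
    then obtain k where "\<And>N. N \<ge> k \<Longrightarrow> cos_avg N \<alpha> n \<le> 1 / 16"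
      by (meson eventually_sequentially less_imp_le)
    then show "(\<alpha>, n) \<in> (\<Union>k. B k)" using n(1) by (auto simp: B_def)
  qed
  \<comment> \<open>\<open>meager_in\<close> asks for equality with a countable union, so each
    \<open>B k\<close> is cut down to \<open>E\<close>.\<close>
  then have "E = \<Union> (range (\<lambda>k. E \<inter> B k))" by blast
  moreover have "nowhere_dense_in gap12_space (E \<inter> B k)" for k
    using nowhere_dense_cos_avg_le[of k] unfolding B_def[symmetric]
    by (rule nowhere_dense_in_subset) blast
  ultimately have "meager_in gap12_space E"
    unfolding meager_in_def by (intro exI[of _ "range (\<lambda>k. E \<inter> B k)"]) auto
  moreover have "?R \<subseteq> topspace gap12_space"
    unfolding topspace_gap12_space by auto
  ultimately show ?thesis by (simp add: residual_in_def E_def)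
qed

end
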